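(* Let $f_i:\mathbb{Z}_N\to\mathbb{C}$ be given by $f_i=s+n_i$ for $i=1,\dots,n$, where $s:\mathbb{Z}_N\to\mathbb{C}$ is fixed and the noises $n_i(x)$ are independent across $i$ and $x$, each circular complex Gaussian with mean $0$ and variance $\sigma^2$. Define the average $$f=\frac1n\sum_{i=1}^n f_i=s+\overline n,\qquad\overline n:=\frac1n\sum_{i=1}^n n_i .$$ Fix $\gamma\in(0,1)$ and set $r_\gamma=\sqrt N+\sqrt{\log(1/\gamma)}$. Then the following hold. (i) With probability at least $1-\gamma$, $$\|\overline n\|_2\le\frac{\sigma}{\sqrt n}r_\gamma,\qquad\|n_i\|_2\le\sigma r_\gamma\quad\text{for each fixed }i.$$ Consequently, if $\|s\|_2\ge2\sigma r_\gamma$, then with probability at least $1-\gamma$, $$\big|\mathrm{FR}(f)-\mathrm{FR}(s)\big|\le\frac{2\sigma r_\gamma}{\sqrt n\,\|s\|_2}\big(\mathrm{FR}(\overline n)+\mathrm{FR}(s)\big),$$ and for each fixed $i$, $$\big|\mathrm{FR}(f_i)-\mathrm{FR}(s)\big|\le\frac{2\sigma r_\gamma}{\|s\|_2}\big(\mathrm{FR}(n_i)+\mathrm{FR}(s)\big).$$ (ii) In particular, on the event in (i) (with $\|s\|_2\ge2\sigma r_\gamma$), the averaged estimate satisfies $$\big|\mathrm{FR}(f)-\mathrm{FR}(s)\big|\le\frac{1}{\sqrt n}C_\gamma(s,n_i,\overline n),\qquad C_\gamma(s,n_i,\overline n)=\frac{2\sigma r_\gamma}{\|s\|_2}\big(\mathrm{FR}(\overline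 n)+\mathrm{FR}(s)\big),$$ so that this bound is smaller by a factor $1/\sqrt n$ relative to the corresponding single-shot bound for $f_i$, up to the replacement of $\mathrm{FR}(n_i)$ by $\mathrm{FR}(\overline n)$, which has the same distribution.
   Context: $N$ is a positive integer and $\mathbb{Z}_N=\mathbb{Z}/N\mathbb{Z}$. For $f:\mathbb{Z}_N\to\mathbb{C}$ the unitary Fourier transform is $\widehat f(m)=N^{-1/2}\sum_{x\in\mathbb{Z}_N}e^{-2\pi i xm/N}f(x)$. $\|g\|_p=\left(\sum_{x\in\mathbb{Z}_N}|g(x)|^p\right)^{1/p}$. The Fourier ratio of a nonzero $f$ is $\mathrm{FR}(f)=\|\widehat f\|_1/\|\widehat f\|_2$. A circular complex Gaussian with mean $0$ and variance $\sigma^2>0$ is a complex random variable whose real and imaginary parts are independent $\mathcal{N}(0,\sigma^2/2)$. $\log$ is the natural logarithm. *)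

theory Defs
  imports "HOL-Probability.Probability"
begin

text \<open>
  The elements of \<open>\<int>/N\<int>\<close> are represented by their residues in \<open>{..<N}\<close>. A function on \<open>\<int>/N\<int>\<close> is
  a function on \<^typ>\<open>nat\<close> of which only the values on \<open>{..<N}\<close> matter.
\<close>

definition lp_norm :: "nat \<Rightarrow> real \<Rightarrow> (nat \<Rightarrow> complex) \<Rightarrow> real" where
  "lp_norm N p g = (\<Sum>x<N. norm (g x) powr p) powr (1 / p)"

definition fourier :: "nat \<Rightarrow> (nat \<Rightarrow> complex) \<Rightarrow> nat \<Rightarrow> complex" where
  "fourier N f m = of_real (1 / sqrt (real N)) *
     (\<Sum>x<N. exp (- (2 * of_real pi * \<i> * of_nat x * of_nat m) / of_nat N) * f x)"

text \<open>
  For \<open>f = 0\<close> on \<open>{..<N}\<close>, where the Fourier ratio is not defined, this gives the value \<open>0\<close>.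
\<close>

definition fourier_ratio :: "nat \<Rightarrow> (nat \<Rightarrow> complex) \<Rightarrow> real" where
  "fourier_ratio N f = lp_norm N 1 (fourier N f) / lp_norm N 2 (fourier N f)"

text \<open>
  The parameter \<open>v\<close> is the variance; \<^const>\<open>normal_density\<close> takes the standard deviation, so the real
  and imaginary parts are \<open>\<N>(0, v/2)\<close>.
\<close>

definition circular_gaussian :: "'w measure \<Rightarrow> real \<Rightarrow> ('w \<Rightarrow> complex) \<Rightarrow> bool" where
  "circular_gaussian M v Z \<longleftrightarrow>
     prob_space.indep_var M borel (\<lambda>\<omega>. Re (Z \<omega>)) borel (\<lambda>\<omega>. Im (Z \<omega>)) \<and>
     distributed M lborel (\<lambda>\<omega>. Re (Z \<omega>)) (normal_density 0 (sqrt (v / 2))) \<and>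
     distributed M lborel (\<lambda>\<omega>. Im (Z \<omega>)) (normal_density 0 (sqrt (v / 2)))"

definition sample_mean :: "nat \<Rightarrow> (nat \<Rightarrow> nat \<Rightarrow> complex) \<Rightarrow> nat \<Rightarrow> complex" where
  "sample_mean n g x = (1 / of_nat n) * (\<Sum>i = 1..n. g i x)"

end

theory Submission
  imports Defs "HOL-Real_Asymp.Real_Asymp"
begin

text \<open>
  By Plancherel and the triangle inequality, a perturbation \<open>h\<close> of \<open>s\<close> with \<open>2 \<parallel>h\<parallel>\<^sub>2 \<le> \<parallel>s\<parallel>\<^sub>2\<close> changes the
  Fourier ratio by at most \<open>2 \<parallel>h\<parallel>\<^sub>2 / \<parallel>s\<parallel>\<^sub>2 (FR h + FR s)\<close>, so only the event of small noise matters.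
  Both of its norm bounds must hold simultaneously with probability \<open>1 - \<gamma>\<close>, hence each may fail only
  with probability \<open>\<gamma>/2\<close>. The squared norm of the noise is a sum of \<open>N\<close> exponential variables, so its
  tail is the Poisson sum \<open>exp (-y) \<Sum>k<N. y^k / k!\<close> at \<open>y = (\<surd>N + a)\<^sup>2\<close>. This sum times \<open>exp a\<^sup>2\<close>
  decreases in \<open>a\<close>, and at \<open>a = 0\<close> it is at most \<open>1/2\<close> by comparing the terms \<open>N - 1 - j\<close> and
  \<open>N + j\<close> of the exponential series. The laws of the Fourier ratios agree because the averaged noise has the law of a
  scaled single noise and the ratio is invariant under scaling.
\<close>

section \<open>Poisson tails\<close>

text \<open>A truncated exponential series: \<open>exp (- y) * exp_partial n y\<close> is the
  probability that a Poisson variable with mean \<open>y\<close> is below \<open>n\<close>.\<close>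

definition exp_partial :: "nat \<Rightarrow> real \<Rightarrow> real" where
  "exp_partial n y = (\<Sum>k<n. y ^ k / fact k)"

text \<open>Multiplication by \<open>y\<close> turns the term with index \<open>k\<close> into
  \<open>Suc k\<close> times the next term, and every index that arises is at most \<open>n\<close>.
  The slightly larger factor \<open>Suc n\<close> is chosen because it plays the role of
  \<open>N\<close> in \<open>poisson_lower_tail\<close>.\<close>

lemma exp_partial_Suc_le:
  assumes "0 \<le> y"
  shows "y * exp_partial n y \<le> real (Suc n) * exp_partial (Suc n) y"
proof -
  have "y * exp_partial n y = (\<Sum>k<n. real (Suc k) * (y ^ Suc k / fact (Suc k)))"
    unfolding exp_partial_def sum_distrib_left
    by (intro sum.cong refl) (simp add: fact_Suc divide_simps del: of_nat_Suc)
  also have "\<dots> = (\<Sum>k<Suc n. real k * (y ^ k / fact k))"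
    by (subst sum.lessThan_Suc_shift) simp
  also have "\<dots> \<le> (\<Sum>k<Suc n. real (Suc n) * (y ^ k / fact k))"
    using assms by (intro sum_mono mult_right_mono) auto
  also have "\<dots> = real (Suc n) * exp_partial (Suc n) y"
    by (simp only: exp_partial_def sum_distrib_left)
  finally show ?thesis .
qed

lemma exp_partial_has_derivative:
  "(exp_partial (Suc n) has_real_derivative exp_partial n y) (at y)"
proof (induction n)
  case 0
  then show ?case by (simp add: exp_partial_def[abs_def])
next
  case (Suc n)
  have eq: "exp_partial (Suc (Suc n)) = (\<lambda>y. exp_partial (Suc n) y + y ^ Suc n / fact (Suc n))"
    by (simp add: exp_partial_def fun_eq_iff)
  have "((\<lambda>y. y ^ Suc n / fact (Suc n)) has_real_derivative real (Suc n) * y ^ n / fact (Suc n)) (at y)"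
    by (rule derivative_eq_intros refl | simp)+
  moreover have "real (Suc n) * y ^ n / fact (Suc n) = y ^ n / fact n"
    by (simp add: fact_Suc divide_simps del: of_nat_Suc)
  ultimately have "((\<lambda>y. y ^ Suc n / fact (Suc n)) has_real_derivative y ^ n / fact n) (at y)"
    by simp
  from DERIV_add[OF Suc this] show ?case
    unfolding eq by (simp add: exp_partial_def)
qed

text \<open>For \<open>j = 0\<close> both terms agree. A step from \<open>j\<close> to
  \<open>Suc j\<close> multiplies the left term by (N - 1 - j) / N and the right one by N / (N + j +
  1). The left factor is the smaller one, since (N - (j + 1)) (N + (j + 1)) is at most N^2.\<close>

lemma power_div_fact_pairing:
  fixes N j :: nat
  assumes "j < N"
  shows "real N ^ (N - 1 - j) / fact (N - 1 - j) \<le> real N ^ (N + j) / fact (N + j)"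
  using assms
proof (induction j)
  case 0
  then obtain m where N: "N = Suc m" by (cases N) auto
  have "real N ^ (N + 0) / fact (N + 0) = real N * real N ^ m / (real N * fact m)"
    by (simp add: N)
  also have "\<dots> = real N ^ m / fact m" using N by simp
  finally show ?case using N by simp
next
  case (Suc j)
  define m where "m = N - 1 - Suc j"
  have N: "N = Suc (Suc j) + m" "N - 1 - j = Suc m" "N + Suc j = Suc (N + j)"
    using Suc.prems by (auto simp: m_def)
  have "real N ^ Suc m / fact (Suc m) \<le> real N ^ (N + j) / fact (N + j)"
    using Suc N by simp
  moreover have "real (Suc m) * real (Suc (N + j)) \<le> real N * real N"
  proof -
    have eqs: "real (Suc m) = real N - real (Suc j)" "real (Suc (N + j)) = real N + real (Suc j)"
      using N by auto
    have "(real N - real (Suc j)) * (real N + real (Suc j)) = real N * real N - real (Suc j) * real (Suc j)"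
      by (simp only: square_diff_square_factored mult.commute)
    then show ?thesis unfolding eqs by simp
  qed
  ultimately have *: "real N ^ Suc m / fact (Suc m) * (real (Suc m) * real (Suc (N + j)))
       \<le> real N ^ (N + j) / fact (N + j) * (real N * real N)"
    by (rule mult_mono) auto
  have "0 < real N" using N by simp
  have "real N ^ m / fact m * (real N * real (Suc (N + j))) =
      real N ^ Suc m / fact (Suc m) * (real (Suc m) * real (Suc (N + j)))"
    by (simp add: fact_Suc divide_simps del: of_nat_Suc)
  also note *
  also have "real N ^ (N + j) / fact (N + j) * (real N * real N) =
      real N ^ Suc (N + j) / fact (Suc (N + j)) * (real N * real (Suc (N + j)))"
    by (simp add: fact_Suc divide_simps del: of_nat_Suc)
  finally have "real N ^ m / fact m \<le> real N ^ Suc (N + j) / fact (Suc (N + j))"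
    using \<open>0 < real N\<close> by (subst (asm) mult_le_cancel_right) auto
  then show ?case by (simp only: N(3) m_def)
qed

lemma exp_partial_le_half_exp: "exp_partial N (real N) \<le> exp (real N) / 2"
proof -
  let ?t = "\<lambda>k. real N ^ k / fact k"
  have "exp_partial N (real N) = (\<Sum>j<N. ?t (N - 1 - j))"
    unfolding exp_partial_def
    by (rule sum.reindex_bij_witness[where i="\<lambda>j. N - 1 - j" and j="\<lambda>j. N - 1 - j"]) auto
  also have "\<dots> \<le> (\<Sum>j<N. ?t (N + j))"
    by (intro sum_mono power_div_fact_pairing) auto
  also have "\<dots> = (\<Sum>k\<in>{N..<2 * N}. ?t k)"
    by (rule sum.reindex_bij_witness[where i="\<lambda>j. j - N" and j="\<lambda>j. N + j"]) auto
  \<comment> \<open>Twice the first \<open>N\<close> terms is at most the sum of the first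
    \<open>2 * N\<close> terms, hence at most the whole series.\<close>
  finally have "2 * exp_partial N (real N) \<le> (\<Sum>k<N. ?t k) + (\<Sum>k\<in>{N..<2 * N}. ?t k)"
    by (simp add: exp_partial_def)
  also have "\<dots> = (\<Sum>k<2 * N. ?t k)"
    by (subst sum.union_disjoint[symmetric]) (auto intro!: sum.cong)
  also have "\<dots> \<le> (\<Sum>k. ?t k)"
    using summable_exp_generic[of "real N"]
    by (intro sum_le_suminf) (auto simp: divide_inverse mult.commute scaleR_conv_of_real)
  also have "\<dots> = exp (real N)"
    by (simp add: exp_def divide_inverse mult.commute)
  finally show ?thesis by simp
qed

lemma poisson_lower_tail:
  fixes N :: nat and a :: real
  assumes "N > 0" "0 \<le> a"
  defines "y \<equiv> (sqrt (real N) + a)\<^sup>2"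
  shows "exp (- y) * exp_partial N y \<le> exp (- a\<^sup>2) / 2"
proof -
  obtain m where m: "N = Suc m" using assms by (cases N) auto
  define c where "c = sqrt (real N)"
  have c: "c > 0" "c\<^sup>2 = real N" using assms by (auto simp: c_def)
  \<comment> \<open>\<open>G u\<close> is exp (u^2) times the Poisson probability at (c + u)^2. With
    c^2 = N the quadratic terms in \<open>u\<close> cancel, which leaves an exponent linear in
    \<open>u\<close>.\<close>
  define G where "G = (\<lambda>u. exp (- real N - 2 * c * u) * exp_partial N ((c + u)\<^sup>2))"
  have "G a \<le> G 0"
  proof (rule DERIV_nonpos_imp_nonincreasing[OF \<open>0 \<le> a\<close>])
    fix u :: real assume u: "0 \<le> u" "u \<le> a"
    let ?y = "(c + u)\<^sup>2"
    let ?D = "2 * exp (- real N - 2 * c * u) * ((c + u) * exp_partial m ?y - c * exp_partial N ?y)"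
    have "((\<lambda>u. exp_partial (Suc m) ((c + u)\<^sup>2)) has_real_derivative exp_partial m ?y * (2 * (c + u))) (at u)"
      by (rule DERIV_chain2[OF exp_partial_has_derivative]) (rule derivative_eq_intros refl | simp)+
    then have "(G has_real_derivative ?D) (at u)"
      unfolding G_def m
      by - (rule derivative_eq_intros refl | assumption | simp add: algebra_simps)+
    moreover have "?D \<le> 0"
    proof -
      have pos: "0 \<le> exp_partial N ?y"
        by (auto simp: exp_partial_def intro!: sum_nonneg)
      \<comment> \<open>The extra factor \<open>c + u\<close> creates (c + u)^2, so that
        \<open>exp_partial_Suc_le\<close> applies with \<open>Suc m\<close> = N = c^2. One factor
        \<open>c\<close> is then enlarged to \<open>c + u\<close> and cancelled.\<close>
      have "(c + u) * ((c + u) * exp_partial m ?y) \<le> c * (c * exp_partial N ?y)"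
        using exp_partial_Suc_le[of ?y m]
        by (simp only: m[symmetric] c(2)[symmetric] power2_eq_square mult.assoc) simp
      also have "\<dots> \<le> (c + u) * (c * exp_partial N ?y)"
        using u c pos by (intro mult_right_mono) auto
      finally have "(c + u) * exp_partial m ?y \<le> c * exp_partial N ?y"
        using u c by (subst (asm) mult_le_cancel_left) auto
      then show ?thesis by (simp add: mult_le_0_iff)
    qed
    ultimately show "\<exists>D. (G has_real_derivative D) (at u) \<and> D \<le> 0" by blast
  qed
  also have "G 0 \<le> 1 / 2"
    using exp_partial_le_half_exp[of N] c by (simp add: G_def exp_minus field_simps)
  finally have "exp (- a\<^sup>2) * G a \<le> exp (- a\<^sup>2) * (1 / 2)"
    by (intro mult_left_mono) auto
  moreover have "exp (- a\<^sup>2) * exp (- real N - 2 * c * a) = exp (- y)"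
    unfolding y_def c(2)[symmetric] c_def[symmetric] using c(1) by (simp add: exp_add[symmetric] power2_eq_square algebra_simps)
  ultimately show ?thesis
    unfolding G_def y_def c_def by (simp add: mult.assoc[symmetric])
qed

section \<open>The squared modulus of a circular Gaussian\<close>

text \<open>In terms of squared radii the area of an annulus is linear; it is obtained as a
  difference of two discs. The \<open>max\<close> accounts for the empty annulus when
  \<open>u < a\<close>.\<close>

lemma emeasure_annulus:
  assumes "0 \<le> a"
  shows "emeasure lborel {z :: real \<times> real. a < (norm z)\<^sup>2 \<and> (norm z)\<^sup>2 \<le> u}
    = ennreal (pi * max 0 (u - a))"
proof (cases "a \<le> u")
  case True
  have le_sqrt: "norm z \<le> sqrt t \<longleftrightarrow> (norm z)\<^sup>2 \<le> t" for z :: "real \<times> real" and t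
    using real_sqrt_le_iff[of "(norm z)\<^sup>2" t] by simp
  have eq: "{z :: real \<times> real. a < (norm z)\<^sup>2 \<and> (norm z)\<^sup>2 \<le> u} = cball 0 (sqrt u) - cball 0 (sqrt a)"
    by (auto simp: le_sqrt not_le)
  have area: "emeasure lborel (cball 0 (sqrt t) :: (real \<times> real) set) = ennreal (pi * t)" if "0 \<le> t" for t
    using that by (subst emeasure_cball) (auto simp: eval_unit_ball_vol)
  have "emeasure lborel (cball 0 (sqrt u) - cball 0 (sqrt a) :: (real \<times> real) set)
      = ennreal (pi * u) - ennreal (pi * a)"
    using assms True by (subst emeasure_Diff) (auto simp: area intro: order_trans[OF _ real_sqrt_le_mono])
  also have "\<dots> = ennreal (pi * max 0 (u - a))"
    using assms True by (subst ennreal_minus) (auto simp: max_def algebra_simps)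
  finally show ?thesis by (simp add: eq)
next
  case False
  then have "{z :: real \<times> real. a < (norm z)\<^sup>2 \<and> (norm z)\<^sup>2 \<le> u} = {}" by fastforce
  then have "emeasure lborel {z :: real \<times> real. a < (norm z)\<^sup>2 \<and> (norm z)\<^sup>2 \<le> u} = 0"
    by (simp only: emeasure_empty)
  with False show ?thesis by simp
qed

text \<open>Layer cake: the Gaussian density is a mixture of indicators of discs with exponential weights.\<close>

lemma nn_integral_gaussian_tail:
  fixes a v :: real
  assumes v: "0 < v" and a: "0 \<le> a"
  shows "(\<integral>\<^sup>+z. ennreal (exp (- (norm z)\<^sup>2 / v) / (pi * v)) * indicator {z. a < (norm z)\<^sup>2} z
            \<partial>(lborel :: (real \<times> real) measure)) = ennreal (exp (- a / v))"
proof -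
  \<comment> \<open>\<open>k\<close> is minus the derivative of the radial profile exp (- t / v) /
    (pi v), so its integral over [t, infinity) gives the profile back.\<close>
  define k where "k = (\<lambda>u. exp (- u / v) / (pi * v\<^sup>2))"
  have k[measurable]: "k \<in> borel_measurable borel" and k0: "0 \<le> k u" for u
    using v by (auto simp: k_def)
  have layer: "ennreal (exp (- t / v) / (pi * v)) = (\<integral>\<^sup>+u. ennreal (k u) * indicator {t..} u \<partial>lborel)" for t
  proof -
    have "((\<lambda>u. - exp (- u / v) / (pi * v)) \<longlongrightarrow> 0) at_top"
      using v by real_asymp
    moreover have "((\<lambda>u. - exp (- u / v) / (pi * v)) has_real_derivative k u) (at u)" for u
      unfolding k_def using v
      by (auto intro!: derivative_eq_intros simp: field_simps power2_eq_square)
    ultimately have "(\<integral>\<^sup>+u. ennreal (k u) * indicator {t..} u \<partial>lborel) = ennreal (0 - - exp (- t / v) / (pi * v))"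
      using k0 by (intro nn_integral_FTC_atLeast) auto
    then show ?thesis by simp
  qed
  have "(\<integral>\<^sup>+z. ennreal (exp (- (norm z)\<^sup>2 / v) / (pi * v)) * indicator {z. a < (norm z)\<^sup>2} z \<partial>(lborel :: (real \<times> real) measure))
    = (\<integral>\<^sup>+z. (\<integral>\<^sup>+u. ennreal (k u) * indicator {z. a < (norm z)\<^sup>2 \<and> (norm z)\<^sup>2 \<le> u} z \<partial>lborel) \<partial>(lborel :: (real \<times> real) measure))"
    unfolding layer
  proof (rule nn_integral_cong)
    fix z :: "real \<times> real"
    have "(\<integral>\<^sup>+u. ennreal (k u) * indicator {(norm z)\<^sup>2..} u \<partial>lborel) * indicator {z. a < (norm z)\<^sup>2} z
      = (\<integral>\<^sup>+u. ennreal (k u) * indicator {(norm z)\<^sup>2..} u * indicator {z. a < (norm z)\<^sup>2} z \<partial>lborel)"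
      by (rule nn_integral_multc[symmetric]) measurable
    also have "\<dots> = (\<integral>\<^sup>+u. ennreal (k u) * indicator {z. a < (norm z)\<^sup>2 \<and> (norm z)\<^sup>2 \<le> u} z \<partial>lborel)"
      by (intro nn_integral_cong) (auto split: split_indicator)
    finally show "(\<integral>\<^sup>+u. ennreal (k u) * indicator {(norm z)\<^sup>2..} u \<partial>lborel) * indicator {z. a < (norm z)\<^sup>2} z = \<dots>" .
  qed
  \<comment> \<open>After this exchange of integrals the inner one is the area of an annulus,
    weighted by \<open>k u\<close>.\<close>
  also have "\<dots> = (\<integral>\<^sup>+u. (\<integral>\<^sup>+z. ennreal (k u) * indicator {z. a < (norm z)\<^sup>2 \<and> (norm z)\<^sup>2 \<le> u} z \<partial>(lborel :: (real \<times> real) measure)) \<partial>lborel)"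
    by (rule lborel_pair.Fubini'[symmetric]) measurable
  also have "\<dots> = (\<integral>\<^sup>+u. ennreal (k u) * ennreal (pi * max 0 (u - a)) \<partial>lborel)"
    by (intro nn_integral_cong, subst nn_integral_cmult_indicator) (auto simp: emeasure_annulus[OF a])
  also have "\<dots> = (\<integral>\<^sup>+u. ennreal (k u * pi * (u - a)) * indicator {a..} u \<partial>lborel)"
    using k0 by (intro nn_integral_cong)
      (auto simp: ennreal_mult'[symmetric] mult.assoc max_def split: split_indicator)
  \<comment> \<open>The integrand is (u - a) exp (- u / v) / v^2; integration by parts yields the
    antiderivative used below. It vanishes at infinity and equals - exp (- a / v) at
    \<open>u = a\<close>.\<close>
  also have "\<dots> = ennreal (0 - (- ((a - a) / v + 1) * exp (- a / v)))"
  proof (rule nn_integral_FTC_atLeast[where F="\<lambda>u. - ((u - a) / v + 1) * exp (- u / v)"])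
    show "((\<lambda>u. - ((u - a) / v + 1) * exp (- u / v)) \<longlongrightarrow> 0) at_top"
      using v by real_asymp
    show "((\<lambda>u. - ((u - a) / v + 1) * exp (- u / v)) has_real_derivative k u * pi * (u - a)) (at u)" for u
      unfolding k_def using v
      by (auto intro!: derivative_eq_intros simp: field_simps power2_eq_square)
  qed (use k0 in auto)
  finally show ?thesis by simp
qed

text \<open>The joint density depends only on the norm, so the Gaussian tail integral gives the
  probability exp (- a / v) of exceeding \<open>a\<close>. These tails determine the exponential law
  with rate \<open>1 / v\<close>.\<close>

lemma (in prob_space) sum_squares_normal_exponential:
  assumes v: "0 < v" and indep: "indep_var borel X borel Y"
    and X: "distributed M lborel X (normal_density 0 (sqrt (v / 2)))"
    and Y: "distributed M lborel Y (normal_density 0 (sqrt (v / 2)))"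
  shows "distributed M lborel (\<lambda>\<omega>. (X \<omega>)\<^sup>2 + (Y \<omega>)\<^sup>2) (exponential_density (1 / v))"
proof -
  have [measurable]: "X \<in> borel_measurable M" "Y \<in> borel_measurable M"
    using indep by (auto simp: indep_var_distribution_eq)
  have "indep_var lborel X lborel Y"
    using indep by (simp add: indep_var_distribution_eq cong: distr_cong)
  then have D: "distributed M (lborel \<Otimes>\<^sub>M lborel) (\<lambda>\<omega>. (X \<omega>, Y \<omega>))
      (\<lambda>(x, y). ennreal (normal_density 0 (sqrt (v / 2)) x) * ennreal (normal_density 0 (sqrt (v / 2)) y))"
    by (intro distributed_joint_indep X Y) (auto intro: lborel.sigma_finite_measure_axioms)
  \<comment> \<open>With component variance v / 2, the exponents add up to - (x^2 + y^2) / v and the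
    two normalising constants multiply to 1 / (pi v).\<close>
  have dens: "(case z of (x, y) \<Rightarrow> ennreal (normal_density 0 (sqrt (v / 2)) x) * ennreal (normal_density 0 (sqrt (v / 2)) y))
      = ennreal (exp (- (norm z)\<^sup>2 / v) / (pi * v))" for z
    using v by (auto simp: normal_density_def norm_Pair ennreal_mult'[symmetric] exp_add[symmetric]
        real_sqrt_mult[symmetric] add_divide_distrib diff_divide_distrib split: prod.split)
  have tail: "prob {\<omega> \<in> space M. a < (X \<omega>)\<^sup>2 + (Y \<omega>)\<^sup>2} = exp (- a / v)" if "0 \<le> a" for a
  proof -
    have "{z :: real \<times> real. a < (norm z)\<^sup>2} \<in> sets (borel \<Otimes>\<^sub>M borel)"
      unfolding borel_prod by measurable
    then have "emeasure M ((\<lambda>\<omega>. (X \<omega>, Y \<omega>)) -` {z. a < (norm z)\<^sup>2} \<inter> space M) = ennreal (exp (- a / v))"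
      using distributed_emeasure[OF D, of "{z. a < (norm z)\<^sup>2}"] nn_integral_gaussian_tail[OF v that]
      unfolding dens by (simp add: lborel_prod)
    moreover have "(\<lambda>\<omega>. (X \<omega>, Y \<omega>)) -` {z. a < (norm z)\<^sup>2} \<inter> space M = {\<omega> \<in> space M. a < (X \<omega>)\<^sup>2 + (Y \<omega>)\<^sup>2}"
      by (auto simp: norm_Pair)
    ultimately show ?thesis by (simp add: measure_def)
  qed
  show ?thesis
  proof (subst exponential_distributed_iff; safe?)
    fix a :: real assume a: "0 \<le> a"
    have "{\<omega> \<in> space M. (X \<omega>)\<^sup>2 + (Y \<omega>)\<^sup>2 \<le> a} = space M - {\<omega> \<in> space M. a < (X \<omega>)\<^sup>2 + (Y \<omega>)\<^sup>2}"
      by auto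
    then show "prob {\<omega> \<in> space M. (X \<omega>)\<^sup>2 + (Y \<omega>)\<^sup>2 \<le> a} = 1 - exp (- a * (1 / v))"
      using tail[OF a] by (simp add: prob_compl)
  qed (use v in auto)
qed

section \<open>Independent Gaussian components\<close>

lemma INT_Sigma: "(\<Inter>p\<in>Sigma J K. F p) = (\<Inter>j\<in>J. \<Inter>k\<in>K j. F (j, k))"
  by blast

text \<open>Independence between blocks and independence inside each block combine to joint
  independence of all components. This turns independent complex values with independent real and
  imaginary parts into one independent real family.\<close>

lemma (in prob_space) indep_vars_Sigma:
  assumes ind: "indep_vars M' Z J" and fin: "finite J" "J \<noteq> {}"
    and K: "\<And>j. j \<in> J \<Longrightarrow> finite (K j) \<and> K j \<noteq> {}"
    and g: "\<And>j k. j \<in> J \<Longrightarrow> k \<in> K j \<Longrightarrow> g j k \<in> measurable (M' j) (L j k)"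
    and ind': "\<And>j. j \<in> J \<Longrightarrow> indep_vars (L j) (\<lambda>k \<omega>. g j k (Z j \<omega>)) (K j)"
  shows "indep_vars (\<lambda>(j, k). L j k) (\<lambda>(j, k) \<omega>. g j k (Z j \<omega>)) (Sigma J K)"
proof -
  have Z: "Z j \<in> measurable M (M' j)" if "j \<in> J" for j
    using ind that by (auto simp: indep_vars_def)
  have ne: "Sigma J K \<noteq> {}" and finS: "finite (Sigma J K)"
    using fin K by fast+
  have rv: "(case p of (j, k) \<Rightarrow> \<lambda>\<omega>. g j k (Z j \<omega>)) \<in> measurable M (case p of (j, k) \<Rightarrow> L j k)"
    if "p \<in> Sigma J K" for p
    using that measurable_compose[OF Z g] by (cases p) simp
  have "indep_vars (\<lambda>(j, k). L j k) (\<lambda>(j, k) \<omega>. g j k (Z j \<omega>)) (Sigma J K) \<longleftrightarrow>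
    (\<forall>A\<in>\<Pi> p\<in>Sigma J K. sets (case p of (j, k) \<Rightarrow> L j k).
        prob (\<Inter>p\<in>Sigma J K. (case p of (j, k) \<Rightarrow> \<lambda>\<omega>. g j k (Z j \<omega>)) -` A p \<inter> space M) =
        (\<Prod>p\<in>Sigma J K. prob ((case p of (j, k) \<Rightarrow> \<lambda>\<omega>. g j k (Z j \<omega>)) -` A p \<inter> space M)))"
    by (rule indep_vars_finite[OF ne finS])
       (simp_all only: sets.sigma_sets_eq rv sets.Int_stable sets.top sets.space_closed)
  also have \<dots>
    proof
      fix A assume "A \<in> (\<Pi> p\<in>Sigma J K. sets (case p of (j, k) \<Rightarrow> L j k))"
      then have A: "A (j, k) \<in> sets (L j k)" if "j \<in> J" "k \<in> K j" for j k
        using that by (auto dest: Pi_mem[of _ _ _ "(j, k)"])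
      \<comment> \<open>\<open>B j\<close> merges the conditions on all components of block
        \<open>j\<close> into a single event for \<open>Z j\<close>. The probability then factors
        first over the blocks and afterwards within each block.\<close>
      define B where "B = (\<lambda>j. \<Inter>k\<in>K j. g j k -` A (j, k) \<inter> space (M' j))"
      have B: "B j \<in> sets (M' j)" if "j \<in> J" for j
        unfolding B_def using that K A by (intro sets.finite_INT measurable_sets[OF g]) auto
      have ZB: "Z j -` B j \<inter> space M = (\<Inter>k\<in>K j. (\<lambda>\<omega>. g j k (Z j \<omega>)) -` A (j, k) \<inter> space M)"
        if "j \<in> J" for j
        using K[OF that] measurable_space[OF Z[OF that]] by (auto simp: B_def)
      have "(\<Inter>p\<in>Sigma J K. (case p of (j, k) \<Rightarrow> \<lambda>\<omega>. g j k (Z j \<omega>)) -` A p \<inter> space M)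
          = (\<Inter>j\<in>J. \<Inter>k\<in>K j. (\<lambda>\<omega>. g j k (Z j \<omega>)) -` A (j, k) \<inter> space M)"
        by (simp only: INT_Sigma prod.case)
      also have "\<dots> = (\<Inter>j\<in>J. Z j -` B j \<inter> space M)"
        by (rule INF_cong[OF refl]) (simp only: ZB)
      also have "prob \<dots> = (\<Prod>j\<in>J. prob (Z j -` B j \<inter> space M))"
        by (rule indep_varsD_finite[OF ind fin(2,1) B])
      also have "\<dots> = (\<Prod>j\<in>J. \<Prod>k\<in>K j. prob ((\<lambda>\<omega>. g j k (Z j \<omega>)) -` A (j, k) \<inter> space M))"
      proof (rule prod.cong[OF refl])
        fix j assume j: "j \<in> J"
        show "prob (Z j -` B j \<inter> space M) = (\<Prod>k\<in>K j. prob ((\<lambda>\<omega>. g j k (Z j \<omega>)) -` A (j, k) \<inter> space M))"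
          unfolding ZB[OF j] using K[OF j] A[OF j] by (intro indep_varsD_finite[OF ind'[OF j]]) simp_all
      qed
      also have "\<dots> = (\<Prod>p\<in>Sigma J K. prob ((case p of (j, k) \<Rightarrow> \<lambda>\<omega>. g j k (Z j \<omega>)) -` A p \<inter> space M))"
        using fin K by (subst prod.Sigma) (simp_all add: split_def)
      finally show "prob (\<Inter>p\<in>Sigma J K. (case p of (j, k) \<Rightarrow> \<lambda>\<omega>. g j k (Z j \<omega>)) -` A p \<inter> space M) = \<dots>" .
    qed
  finally show ?thesis .
qed

lemma (in prob_space) indep_var_of_indep_vars:
  assumes "indep_vars (\<lambda>_. borel) X I" "i \<in> I" "j \<in> I" "i \<noteq> j"
  shows "indep_var borel (X i) borel (X j)"
proof -
  have "indep_var borel ((\<lambda>f. f i) \<circ> (\<lambda>\<omega>. restrict (\<lambda>i. X i \<omega>) {i}))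
      borel ((\<lambda>f. f j) \<circ> (\<lambda>\<omega>. restrict (\<lambda>i. X i \<omega>) {j}))"
    using assms by (intro indep_var_compose[OF indep_var_restrict[OF assms(1)]]) auto
  then show ?thesis by (simp add: comp_def)
qed

text \<open>A boolean index for the real and imaginary parts makes the real coordinates of a noise
  vector a single family over a product index set.\<close>

definition part :: "bool \<Rightarrow> complex \<Rightarrow> real" where
  "part b z = (if b then Re z else Im z)"

lemma part_sum: "part b (\<Sum>i\<in>I. z i) = (\<Sum>i\<in>I. part b (z i))"
  by (simp add: part_def)

lemma part_of_real_mult: "part b (of_real c * z) = c * part b z"
  by (simp add: part_def)

lemma part_measurable [measurable]: "part b \<in> borel_measurable borel"
  unfolding part_def[abs_def] by (cases b) simp_all

text \<open>Here \<open>v\<close> is the variance of a complex entry, hence \<open>v / 2\<close> for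
  each real coordinate. Independence is imposed on all \<open>2 * N\<close> real coordinates at
  once, a form that passes to sums and multiples and determines the joint law.\<close>

definition (in prob_space) gaussian_noise :: "nat \<Rightarrow> real \<Rightarrow> ('a \<Rightarrow> nat \<Rightarrow> complex) \<Rightarrow> bool" where
  "gaussian_noise N v Z \<longleftrightarrow>
     indep_vars (\<lambda>_. borel) (\<lambda>(x, b) \<omega>. part b (Z \<omega> x)) ({..<N} \<times> UNIV) \<and>
     (\<forall>x<N. \<forall>b. distributed M lborel (\<lambda>\<omega>. part b (Z \<omega> x)) (normal_density 0 (sqrt (v / 2))))"

section \<open>Stability of the Fourier ratio\<close>

lemma lp_norm_1: "lp_norm N 1 g = (\<Sum>x<N. norm (g x))"
  by (simp add: lp_norm_def sum_nonneg)

lemma lp_norm_2: "lp_norm N 2 g = L2_set (\<lambda>x. norm (g x)) {..<N}"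
  by (simp add: lp_norm_def L2_set_def powr_half_sqrt sum_nonneg)

lemma lp_norm_nonneg: "0 \<le> lp_norm N p g"
  by (simp add: lp_norm_def)

lemma lp_norm_1_triangle: "lp_norm N 1 (\<lambda>x. g x + h x) \<le> lp_norm N 1 g + lp_norm N 1 h"
  by (simp add: lp_norm_1 sum.distrib[symmetric] sum_mono norm_triangle_ineq)

lemma lp_norm_2_triangle: "lp_norm N 2 (\<lambda>x. g x + h x) \<le> lp_norm N 2 g + lp_norm N 2 h"
  unfolding lp_norm_2
  by (rule order_trans[OF _ L2_set_triangle_ineq]) (auto intro!: L2_set_mono norm_triangle_ineq)

lemma lp_norm_cmult:
  assumes "p > 0"
  shows "lp_norm N p (\<lambda>x. c * g x) = norm c * lp_norm N p g"
  using assms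
  by (simp add: lp_norm_def norm_mult powr_mult sum_distrib_left[symmetric] powr_powr sum_nonneg)

lemma fourier_add: "fourier N (\<lambda>x. g x + h x) = (\<lambda>m. fourier N g m + fourier N h m)"
  by (simp add: fourier_def fun_eq_iff algebra_simps sum.distrib)

lemma fourier_cmult: "fourier N (\<lambda>x. c * g x) = (\<lambda>m. c * fourier N g m)"
  by (simp add: fourier_def fun_eq_iff sum_distrib_left algebra_simps)

lemma fourier_ratio_cmult:
  assumes "c \<noteq> 0"
  shows "fourier_ratio N (\<lambda>x. c * g x) = fourier_ratio N g"
  using assms by (simp add: fourier_ratio_def fourier_cmult lp_norm_cmult)

lemma fourier_ratio_nonneg: "0 \<le> fourier_ratio N g"
  by (simp add: fourier_ratio_def lp_norm_nonneg)

text \<open>Off the diagonal this is a geometric sum whose ratio \<open>z\<close> is an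
  \<open>N\<close>-th root of unity. The ratio differs from 1 because \<open>N\<close> cannot divide
  a nonzero difference of two residues.\<close>

lemma sum_characters:
  assumes "x < N" "y < N"
  shows "(\<Sum>m<N. exp (- (2 * of_real pi * \<i> * of_nat x * of_nat m) / of_nat N) *
           cnj (exp (- (2 * of_real pi * \<i> * of_nat y * of_nat m) / of_nat N)))
         = (if x = y then of_nat N else 0 :: complex)"
proof -
  define z where "z = exp (2 * of_real pi * \<i> * (of_int (int y - int x)) / of_nat N :: complex)"
  have eq: "exp (- (2 * of_real pi * \<i> * of_nat x * of_nat m) / of_nat N) *
           cnj (exp (- (2 * of_real pi * \<i> * of_nat y * of_nat m) / of_nat N)) = z ^ m" for m
    unfolding z_def exp_of_nat_mult[symmetric] exp_cnj exp_add[symmetric]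
    by (rule arg_cong[where f=exp]) (simp add: add_divide_distrib[symmetric] algebra_simps)
  have N: "N > 0" using assms by simp
  show ?thesis
  proof (cases "x = y")
    case True
    then show ?thesis unfolding eq by (simp add: z_def)
  next
    case False
    have "z \<noteq> 1"
    proof
      assume "z = 1"
      then obtain k :: int where k: "2 * pi * (of_int (int y - int x)) / real N = of_int (2 * k) * pi"
        unfolding z_def exp_eq_1 by auto
      have "pi * (2 * real_of_int (int y - int x)) = pi * (2 * of_int (k * int N))"
        using N k by (simp add: field_simps)
      then have "real_of_int (int y - int x) = of_int (k * int N)"
        by (subst (asm) mult_left_cancel) auto
      then have d: "int y - int x = k * int N" by (rule of_int_eq_iff[THEN iffD1])
      then have "int N dvd int y - int x" by simp
      moreover have "\<bar>int y - int x\<bar> < int N" using assms by auto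
      ultimately show False using False dvd_imp_le_int[of "int y - int x" "int N"] by auto
    qed
    moreover have "z ^ N = 1"
    proof -
      have "z ^ N = exp (2 * of_real pi * \<i> * (of_int (int y - int x)))"
        unfolding z_def exp_of_nat_mult[symmetric] using N by simp
      also have "\<dots> = 1" unfolding exp_eq_1 by (auto intro!: exI[of _ "int y - int x"])
      finally show ?thesis .
    qed
    ultimately show ?thesis unfolding eq using False by (simp add: sum_gp_strict)
  qed
qed

lemma plancherel:
  assumes "N > 0"
  shows "lp_norm N 2 (fourier N g) = lp_norm N 2 g"
proof -
  let ?e = "\<lambda>x m. exp (- (2 * of_real pi * \<i> * of_nat x * of_nat m) / of_nat N) :: complex"
  have "of_real (\<Sum>m<N. (norm (fourier N g m))\<^sup>2) = (\<Sum>m<N. fourier N g m * cnj (fourier N g m))"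
    by (simp only: of_real_sum complex_norm_square)
  also have "\<dots> = (\<Sum>m<N. of_real (1 / real N) * (\<Sum>x<N. \<Sum>y<N. g x * cnj (g y) * (?e x m * cnj (?e y m))))"
  proof (rule sum.cong[OF refl])
    fix m
    have s: "complex_of_real (1 / sqrt (real N)) * of_real (1 / sqrt (real N)) = of_real (1 / real N)"
      by (simp flip: of_real_mult)
    have "fourier N g m * cnj (fourier N g m) = of_real (1 / sqrt (real N)) * of_real (1 / sqrt (real N)) *
        ((\<Sum>x<N. ?e x m * g x) * (\<Sum>y<N. cnj (?e y m) * cnj (g y)))"
      by (simp add: fourier_def mult_ac)
    also have "\<dots> = of_real (1 / real N) * (\<Sum>x<N. \<Sum>y<N. g x * cnj (g y) * (?e x m * cnj (?e y m)))"
      unfolding s sum_product by (simp add: mult_ac)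
    finally show "fourier N g m * cnj (fourier N g m) = \<dots>" .
  qed
  \<comment> \<open>The sum over frequencies is moved inside, where orthogonality of characters
    leaves only the diagonal; its factor \<open>N\<close> cancels the normalisation.\<close>
  also have "\<dots> = of_real (1 / real N) * (\<Sum>x<N. \<Sum>y<N. g x * cnj (g y) * (\<Sum>m<N. ?e x m * cnj (?e y m)))"
    unfolding sum_distrib_left[symmetric]
    by (rule arg_cong[where f="(*) _"], subst sum.swap, rule sum.cong[OF refl],
        subst sum.swap, simp only: sum_distrib_left)
  also have "\<dots> = of_real (1 / real N) * (\<Sum>x<N. \<Sum>y<N. g x * cnj (g y) * (if x = y then of_nat N else 0))"
    by (intro arg_cong2[where f="(*)"] sum.cong refl) (simp only: sum_characters lessThan_iff)
  also have "\<dots> = (\<Sum>x<N. g x * cnj (g x))"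
    using assms by (simp add: if_distrib sum_distrib_left cong: if_cong)
  also have "\<dots> = of_real (\<Sum>x<N. (norm (g x))\<^sup>2)"
    by (simp only: of_real_sum complex_norm_square)
  finally show ?thesis
    by (simp only: of_real_eq_iff lp_norm_2 L2_set_def)
qed

text \<open>The identity A'/B' - A/B = ((A' - A) + (A/B) (B - B')) / B' separates the changes of the
  two norms. Each change is bounded by the triangle inequality, and the smallness of
  \<open>h\<close> keeps B' at least B / 2.\<close>

lemma fourier_ratio_perturb:
  assumes "N > 0" "0 < lp_norm N 2 s" "2 * lp_norm N 2 h \<le> lp_norm N 2 s"
  shows "\<bar>fourier_ratio N (\<lambda>x. s x + h x) - fourier_ratio N s\<bar>
    \<le> 2 * lp_norm N 2 h / lp_norm N 2 s * (fourier_ratio N h + fourier_ratio N s)"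
proof -
  define A B A' B' a b where
    "A = lp_norm N 1 (fourier N s)" "B = lp_norm N 2 (fourier N s)"
    "A' = lp_norm N 1 (fourier N (\<lambda>x. s x + h x))" "B' = lp_norm N 2 (fourier N (\<lambda>x. s x + h x))"
    "a = lp_norm N 1 (fourier N h)" "b = lp_norm N 2 (fourier N h)"
  note defs = this
  have minus: "lp_norm N p (fourier N (\<lambda>x. - 1 * h x)) = lp_norm N p (fourier N h)" if "p > 0" for p
    unfolding fourier_cmult using lp_norm_cmult[OF that, of N "- 1"] by simp
  \<comment> \<open>Writing \<open>s\<close> as the perturbed signal minus \<open>h\<close> supplies
    the reverse triangle inequalities.\<close>
  have "fourier N s = fourier N (\<lambda>x. (s x + h x) + - 1 * h x)" by simp
  also have "\<dots> = (\<lambda>m. fourier N (\<lambda>x. s x + h x) m + fourier N (\<lambda>x. - 1 * h x) m)"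
    by (rule fourier_add)
  finally have s: "fourier N s = \<dots>" .
  have "A' \<le> A + a" "B' \<le> B + b"
    unfolding defs fourier_add by (rule lp_norm_1_triangle lp_norm_2_triangle)+
  moreover have "A \<le> A' + a"
    using lp_norm_1_triangle[of N "fourier N (\<lambda>x. s x + h x)" "fourier N (\<lambda>x. - 1 * h x)"]
    unfolding defs s[symmetric] minus[OF zero_less_one] .
  moreover have "B \<le> B' + b"
    using lp_norm_2_triangle[of N "fourier N (\<lambda>x. s x + h x)" "fourier N (\<lambda>x. - 1 * h x)"]
    unfolding defs s[symmetric] minus[OF zero_less_numeral] .
  moreover have B: "0 < B" "2 * b \<le> B" using assms by (simp_all add: defs plancherel)
  ultimately have dA: "\<bar>A' - A\<bar> \<le> a" and dB: "\<bar>B - B'\<bar> \<le> b" and B': "B \<le> 2 * B'" "0 < B'"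
    by auto
  have nn: "0 \<le> a" "0 \<le> b" "0 \<le> A" by (simp_all add: defs lp_norm_nonneg)
  \<comment> \<open>If \<open>b = 0\<close>, the transform of \<open>h\<close> vanishes and so does
    \<open>a\<close>. The default value 0 of the Fourier ratio of zero noise therefore does no
    harm.\<close>
  have a: "a = b * (a / b)"
  proof (cases "b = 0")
    case True
    then have "fourier N h m = 0" if "m < N" for m
      using that by (simp add: defs lp_norm_2 L2_set_eq_0_iff)
    then have "a = 0" by (simp add: defs lp_norm_1)
    then show ?thesis by simp
  qed simp
  have "\<bar>A' / B' - A / B\<bar> = \<bar>(A' - A) + A / B * (B - B')\<bar> / B'"
    using B B' by (simp add: field_simps)
  also have "\<dots> \<le> (a + A / B * b) / B'"
  proof (rule divide_right_mono)
    have "\<bar>(A' - A) + A / B * (B - B')\<bar> \<le> \<bar>A' - A\<bar> + A / B * \<bar>B - B'\<bar>"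
      using nn B by (intro order_trans[OF abs_triangle_ineq]) (simp add: abs_mult)
    also have "\<dots> \<le> a + A / B * b"
      using dA dB nn B by (intro add_mono mult_left_mono) auto
    finally show "\<bar>(A' - A) + A / B * (B - B')\<bar> \<le> a + A / B * b" .
  qed (use B' in simp)
  also have "\<dots> = b * (a / b + A / B) / B'"
    by (subst a) (simp add: algebra_simps)
  also have "\<dots> \<le> b * (a / b + A / B) / (B / 2)"
    using B B' nn by (intro divide_left_mono mult_nonneg_nonneg add_nonneg_nonneg) auto
  also have "\<dots> = 2 * b / B * (a / b + A / B)"
    by (simp only: divide_divide_eq_right times_divide_eq_left times_divide_eq_right mult_ac)
  finally show ?thesis
    using plancherel[OF assms(1)] unfolding fourier_ratio_def defs by simp
qed

lemma fourier_ratio_perturb_le: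
  assumes "N > 0" "0 < lp_norm N 2 s" "lp_norm N 2 h \<le> d" "2 * d \<le> lp_norm N 2 s"
  shows "\<bar>fourier_ratio N (\<lambda>x. s x + h x) - fourier_ratio N s\<bar>
    \<le> 2 * d / lp_norm N 2 s * (fourier_ratio N h + fourier_ratio N s)"
  using assms
  by (intro order_trans[OF fourier_ratio_perturb] mult_right_mono divide_right_mono)
     (auto intro: add_nonneg_nonneg fourier_ratio_nonneg)

section \<open>Gaussian noise vectors\<close>

text \<open>Variances of independent normals add, coordinate by coordinate. A singleton
  \<open>I\<close> also covers a single noise vector.\<close>

lemma (in prob_space) gaussian_noise_sum:
  assumes I: "finite I" "I \<noteq> {}" and v: "0 < v"
    and ind: "indep_vars (\<lambda>_. borel) (\<lambda>((i, x), b) \<omega>. part b (Z i \<omega> x)) ((I \<times> {..<N}) \<times> UNIV)"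
    and dist: "\<And>i x b. i \<in> I \<Longrightarrow> x < N \<Longrightarrow>
      distributed M lborel (\<lambda>\<omega>. part b (Z i \<omega> x)) (normal_density 0 (sqrt (v / 2)))"
  shows "gaussian_noise N (real (card I) * v) (\<lambda>\<omega> x. \<Sum>i\<in>I. Z i \<omega> x)"
  unfolding gaussian_noise_def
proof (intro conjI allI impI)
  let ?X = "\<lambda>((i, x), b) \<omega>. part b (Z i \<omega> x)"
  \<comment> \<open>The block for \<open>(x, b)\<close> collects that coordinate from all summands.
    The blocks are disjoint, so their sums are independent.\<close>
  let ?K = "\<lambda>(x, b). (\<lambda>i. ((i, x), b)) ` I"
  have "indep_vars (\<lambda>p. PiM (?K p) (\<lambda>_. borel)) (\<lambda>p \<omega>. restrict (\<lambda>q. ?X q \<omega>) (?K p)) ({..<N} \<times> UNIV)"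
    by (rule indep_vars_restrict[OF ind]) (auto simp: disjoint_family_on_def)
  then have "indep_vars (\<lambda>_. borel)
     (\<lambda>p \<omega>. (\<lambda>f. \<Sum>i\<in>I. f ((i, fst p), snd p)) (restrict (\<lambda>q. ?X q \<omega>) (?K p))) ({..<N} \<times> (UNIV :: bool set))"
    by (rule indep_vars_compose2) (auto intro!: borel_measurable_sum measurable_component_singleton)
  also have "?this \<longleftrightarrow> indep_vars (\<lambda>_. borel) (\<lambda>(x, b) \<omega>. part b (\<Sum>i\<in>I. Z i \<omega> x)) ({..<N} \<times> UNIV)"
    by (intro indep_vars_cong) (auto simp: part_sum fun_eq_iff)
  finally show "indep_vars (\<lambda>_. borel) (\<lambda>(x, b) \<omega>. part b (\<Sum>i\<in>I. Z i \<omega> x)) ({..<N} \<times> UNIV)" .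
next
  fix x :: nat and b :: bool assume x: "x < N"
  let ?X = "\<lambda>((i, x), b) \<omega>. part b (Z i \<omega> x)"
  let ?J = "(\<lambda>i. ((i, x), b)) ` I"
  have inj: "inj_on (\<lambda>i. ((i, x), b)) I" by (auto simp: inj_on_def)
  have "indep_vars (\<lambda>_. borel) ?X ?J"
    using x by (intro indep_vars_subset[OF ind]) auto
  then have "distributed M lborel (\<lambda>\<omega>. \<Sum>p\<in>?J. ?X p \<omega>)
      (normal_density (\<Sum>p\<in>?J. 0) (sqrt (\<Sum>p\<in>?J. (sqrt (v / 2))\<^sup>2)))"
    using I v x by (intro sum_indep_normal) (auto intro: dist)
  then show "distributed M lborel (\<lambda>\<omega>. part b (\<Sum>i\<in>I. Z i \<omega> x))
      (normal_density 0 (sqrt (real (card I) * v / 2)))"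
    using v by (simp add: sum.reindex[OF inj] part_sum card_image[OF inj])
qed

lemma (in prob_space) gaussian_noise_scale:
  assumes "gaussian_noise N v Z" "0 < v" "0 < c"
  shows "gaussian_noise N (c\<^sup>2 * v) (\<lambda>\<omega> x. of_real c * Z \<omega> x)"
  unfolding gaussian_noise_def
proof (intro conjI allI impI)
  have ind: "indep_vars (\<lambda>_. borel) (\<lambda>(x, b) \<omega>. part b (Z \<omega> x)) ({..<N} \<times> UNIV)"
    using assms(1) by (simp add: gaussian_noise_def)
  have "indep_vars (\<lambda>_. borel) (\<lambda>p \<omega>. (\<lambda>t. c * t) ((case p of (x, b) \<Rightarrow> \<lambda>\<omega>. part b (Z \<omega> x)) \<omega>)) ({..<N} \<times> UNIV)"
    by (rule indep_vars_compose2[OF ind]) simp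
  also have "?this \<longleftrightarrow> indep_vars (\<lambda>_. borel) (\<lambda>(x, b) \<omega>. part b (of_real c * Z \<omega> x)) ({..<N} \<times> UNIV)"
    by (intro indep_vars_cong) (auto simp: part_of_real_mult fun_eq_iff)
  finally show "indep_vars (\<lambda>_. borel) (\<lambda>(x, b) \<omega>. part b (of_real c * Z \<omega> x)) ({..<N} \<times> UNIV)" .
next
  fix x b assume "x < N"
  then have "distributed M lborel (\<lambda>\<omega>. part b (Z \<omega> x)) (normal_density 0 (sqrt (v / 2)))"
    using assms(1) by (simp add: gaussian_noise_def)
  then have "distributed M lborel (\<lambda>\<omega>. 0 + c * part b (Z \<omega> x)) (normal_density (0 + c * 0) (\<bar>c\<bar> * sqrt (v / 2)))"
    using assms by (intro normal_density_affine) auto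
  moreover have "\<bar>c\<bar> * sqrt (v / 2) = sqrt (c\<^sup>2 * v / 2)"
    by (simp only: times_divide_eq_right[symmetric] real_sqrt_mult real_sqrt_abs)
  ultimately show "distributed M lborel (\<lambda>\<omega>. part b (of_real c * Z \<omega> x)) (normal_density 0 (sqrt (c\<^sup>2 * v / 2)))"
    by (simp only: part_of_real_mult add_0_left mult_zero_right)
qed

lemma (in prob_space) gaussian_noise_measurable:
  assumes "gaussian_noise N v Z" "x < N"
  shows "(\<lambda>\<omega>. Z \<omega> x) \<in> borel_measurable M"
proof -
  have "(\<lambda>\<omega>. part b (Z \<omega> x)) \<in> borel_measurable M" for b
    using assms by (auto simp: gaussian_noise_def distributed_def)
  from this[of True] this[of False] show ?thesis
    by (simp add: part_def borel_measurable_complex_iff)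
qed

text \<open>The squared norm is a sum of \<open>N\<close> independent exponential variables, and the
  tail of this Erlang law is a Poisson probability. The factor 1/2 leaves room for a union bound
  over two noise vectors.\<close>

lemma (in prob_space) gaussian_noise_tail:
  assumes Z: "gaussian_noise N v Z" and v: "0 < v" and N: "0 < N" and a: "0 \<le> a"
  shows "prob {\<omega> \<in> space M. \<not> lp_norm N 2 (Z \<omega>) \<le> sqrt v * (sqrt (real N) + a)} \<le> exp (- a\<^sup>2) / 2"
proof -
  define y where "y = (sqrt (real N) + a)\<^sup>2"
  let ?X = "\<lambda>(x, b) \<omega>. part b (Z \<omega> x)"
  let ?S = "\<lambda>\<omega>. \<Sum>x<N. (norm (Z \<omega> x))\<^sup>2"
  have ind: "indep_vars (\<lambda>_. borel) ?X ({..<N} \<times> UNIV)"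
    and dist: "\<And>x b. x < N \<Longrightarrow> distributed M lborel (\<lambda>\<omega>. part b (Z \<omega> x)) (normal_density 0 (sqrt (v / 2)))"
    using Z by (auto simp: gaussian_noise_def)
  have norm2: "(norm z)\<^sup>2 = (part True z)\<^sup>2 + (part False z)\<^sup>2" for z
    by (simp add: part_def cmod_power2)
  have "indep_vars (\<lambda>x. PiM ({x} \<times> UNIV) (\<lambda>_. borel)) (\<lambda>x \<omega>. restrict (\<lambda>q. ?X q \<omega>) ({x} \<times> UNIV)) {..<N}"
    by (rule indep_vars_restrict[OF ind]) (auto simp: disjoint_family_on_def)
  then have "indep_vars (\<lambda>_. borel)
     (\<lambda>x \<omega>. (\<lambda>f. (f (x, True))\<^sup>2 + (f (x, False))\<^sup>2) (restrict (\<lambda>q. ?X q \<omega>) ({x} \<times> UNIV))) {..<N}"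
    by (rule indep_vars_compose2)
       (auto intro!: borel_measurable_add borel_measurable_power measurable_component_singleton)
  then have ind2: "indep_vars (\<lambda>_. borel) (\<lambda>x \<omega>. (norm (Z \<omega> x))\<^sup>2) {..<N}"
    by (simp add: norm2)
  \<comment> \<open>\<open>erlang_density k\<close> describes a sum of \<open>k + 1\<close>
    exponential variables, hence the shift by one.\<close>
  have "distributed M lborel ?S (erlang_density (card {..<N} - 1) (1 / v))"
  proof (rule exponential_distributed_sum[OF _ _ _ _ ind2])
    fix x assume "x \<in> {..<N}"
    then have x: "x < N" by simp
    have "indep_var borel (?X (x, True)) borel (?X (x, False))"
      using x by (intro indep_var_of_indep_vars[OF ind]) auto
    then show "distributed M lborel (\<lambda>\<omega>. (norm (Z \<omega> x))\<^sup>2) (exponential_density (1 / v))"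
      unfolding norm2 using x v by (intro sum_squares_normal_exponential dist) auto
  qed (use N v in auto)
  then have "prob {\<omega> \<in> space M. v * y < ?S \<omega>} = 1 - erlang_CDF (N - 1) (1 / v) (v * y)"
    using v by (subst erlang_distributed_gt) (auto simp: y_def)
  also have "\<dots> = exp (- y) * exp_partial N y"
    using v N by (auto simp: erlang_CDF_def y_def mult_less_0_iff exp_partial_def sum_distrib_left
        mult.commute lessThan_Suc_atMost[symmetric])
  also have "\<dots> \<le> exp (- a\<^sup>2) / 2"
    unfolding y_def by (rule poisson_lower_tail[OF N a])
  finally have "prob {\<omega> \<in> space M. v * y < ?S \<omega>} \<le> exp (- a\<^sup>2) / 2" .
  moreover have "\<not> lp_norm N 2 (Z \<omega>) \<le> sqrt v * (sqrt (real N) + a) \<longleftrightarrow> v * y < ?S \<omega>" for \<omega>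
  proof -
    have "sqrt v * (sqrt (real N) + a) = sqrt (v * y)"
      using a by (simp add: y_def real_sqrt_mult)
    then show ?thesis by (simp add: lp_norm_2 L2_set_def not_le)
  qed
  ultimately show ?thesis by simp
qed

section \<open>Measurability and law of the Fourier ratio of noise\<close>

lemma fourier_ratio_measurable:
  assumes "\<And>x. x < N \<Longrightarrow> (\<lambda>\<omega>. g \<omega> x) \<in> borel_measurable M"
  shows "(\<lambda>\<omega>. fourier_ratio N (g \<omega>)) \<in> borel_measurable M"
proof -
  have [measurable]: "(\<lambda>\<omega>. fourier N (g \<omega>) m) \<in> borel_measurable M" for m
    unfolding fourier_def using assms
    by (intro borel_measurable_times borel_measurable_sum borel_measurable_const) auto
  show ?thesis
    unfolding fourier_ratio_def lp_norm_1 lp_norm_2 L2_set_def by measurable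
qed

lemma fourier_ratio_cong:
  assumes "\<And>x. x < N \<Longrightarrow> g x = h x"
  shows "fourier_ratio N g = fourier_ratio N h"
proof -
  have "fourier N g = fourier N h"
    using assms by (simp add: fourier_def fun_eq_iff)
  then show ?thesis by (simp add: fourier_ratio_def)
qed

text \<open>Both ratios are the same measurable function \<open>F\<close> of the vector of real
  coordinates. The law of that vector is a product of normal laws determined by \<open>N\<close> and
  \<open>v\<close>.\<close>

lemma (in prob_space) gaussian_noise_law:
  assumes Z: "gaussian_noise N v Z" and W: "gaussian_noise N v W" and "0 < N"
  shows "distr M borel (\<lambda>\<omega>. fourier_ratio N (Z \<omega>)) = distr M borel (\<lambda>\<omega>. fourier_ratio N (W \<omega>))"
proof -
  define I where "I = {..<N} \<times> (UNIV :: bool set)"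
  define P where "P = PiM I (\<lambda>_. borel :: real measure)"
  define F where "F = (\<lambda>u. fourier_ratio N (\<lambda>x. of_real (u (x, True)) + \<i> * of_real (u (x, False))))"
  have [measurable]: "(\<lambda>u. u (x, b)) \<in> borel_measurable P" if "x < N" for x b
    unfolding P_def using that by (intro measurable_component_singleton) (auto simp: I_def)
  have F: "F \<in> borel_measurable P"
    unfolding F_def by (intro fourier_ratio_measurable) measurable
  have key: "distr M borel (\<lambda>\<omega>. fourier_ratio N (Y \<omega>)) =
      distr (PiM I (\<lambda>_. density lborel (normal_density 0 (sqrt (v / 2))))) borel F"
    if Y: "gaussian_noise N v Y" for Y
  proof -
    let ?X = "\<lambda>(x, b) \<omega>. part b (Y \<omega> x)"
    have ind: "indep_vars (\<lambda>_. borel) ?X I"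
      and dist: "\<And>x b. x < N \<Longrightarrow> distributed M lborel (\<lambda>\<omega>. part b (Y \<omega> x)) (normal_density 0 (sqrt (v / 2)))"
      using Y by (auto simp: gaussian_noise_def I_def)
    have rv: "?X p \<in> borel_measurable M" if "p \<in> I" for p
      using ind that by (auto simp: indep_vars_def)
    then have vec: "(\<lambda>\<omega>. \<lambda>p\<in>I. ?X p \<omega>) \<in> measurable M P"
      unfolding P_def by (intro measurable_restrict) auto
    have "I \<noteq> {}" using \<open>0 < N\<close> by (auto simp: I_def)
    then have "distr M P (\<lambda>\<omega>. \<lambda>p\<in>I. ?X p \<omega>) = PiM I (\<lambda>p. distr M borel (?X p))"
      unfolding P_def using ind rv by (subst indep_vars_iff_distr_eq_PiM'[symmetric]) auto
    also have "\<dots> = PiM I (\<lambda>_. density lborel (normal_density 0 (sqrt (v / 2))))"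
    proof (rule PiM_cong[OF refl])
      fix p assume "p \<in> I"
      then have "distributed M lborel (?X p) (normal_density 0 (sqrt (v / 2)))"
        by (auto simp: I_def intro: dist)
      from distributed_distr_eq_density[OF this]
      show "distr M borel (?X p) = density lborel (normal_density 0 (sqrt (v / 2)))"
        by (simp cong: distr_cong)
    qed
    finally have "distr (PiM I (\<lambda>_. density lborel (normal_density 0 (sqrt (v / 2))))) borel F
        = distr M borel (F \<circ> (\<lambda>\<omega>. \<lambda>p\<in>I. ?X p \<omega>))"
      using distr_distr[OF F vec] by simp
    \<comment> \<open>\<open>restrict\<close> alters coordinates only outside \<open>I\<close>,
      whereas the Fourier ratio sees only positions below \<open>N\<close>.\<close>
    moreover have "F \<circ> (\<lambda>\<omega>. \<lambda>p\<in>I. ?X p \<omega>) = (\<lambda>\<omega>. fourier_ratio N (Y \<omega>))"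
      by (auto simp: F_def I_def part_def fun_eq_iff simp flip: complex_eq intro!: fourier_ratio_cong)
    ultimately show ?thesis by simp
  qed
  show ?thesis using key[OF Z] key[OF W] by simp
qed

lemma (in prob_space) circular_gaussian_part:
  assumes "circular_gaussian M v Z"
  shows "distributed M lborel (\<lambda>\<omega>. part b (Z \<omega>)) (normal_density 0 (sqrt (v / 2)))"
    and "indep_vars (\<lambda>_. borel) (\<lambda>b \<omega>. part b (Z \<omega>)) UNIV"
proof -
  show "distributed M lborel (\<lambda>\<omega>. part b (Z \<omega>)) (normal_density 0 (sqrt (v / 2)))"
    using assms by (cases b) (simp_all add: circular_gaussian_def part_def)
  have "indep_vars (case_bool borel borel) (case_bool (\<lambda>\<omega>. Re (Z \<omega>)) (\<lambda>\<omega>. Im (Z \<omega>))) UNIV"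
    using assms by (simp add: circular_gaussian_def indep_var_def)
  also have "?this \<longleftrightarrow> indep_vars (\<lambda>_. borel) (\<lambda>b \<omega>. part b (Z \<omega>)) UNIV"
    by (intro indep_vars_cong) (auto simp: part_def split: bool.split)
  finally show "indep_vars (\<lambda>_. borel) (\<lambda>b \<omega>. part b (Z \<omega>)) UNIV" .
qed

lemma lp_norm_2_measurable:
  assumes "\<And>x. x < N \<Longrightarrow> (\<lambda>\<omega>. g \<omega> x) \<in> borel_measurable M"
  shows "(\<lambda>\<omega>. lp_norm N 2 (g \<omega>)) \<in> borel_measurable M"
proof -
  have "(\<lambda>\<omega>. \<Sum>x<N. (norm (g \<omega> x))\<^sup>2) \<in> borel_measurable M"
    using assms by (intro borel_measurable_sum borel_measurable_power borel_measurable_norm) auto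
  then show ?thesis
    unfolding lp_norm_2 L2_set_def by measurable
qed

lemma sample_mean_add:
  assumes "0 < n"
  shows "sample_mean n (\<lambda>i x. s x + g i x) y = s y + sample_mean n g y"
  using assms by (simp add: sample_mean_def sum.distrib algebra_simps)

section \<open>The averaged and single-shot estimates\<close>

theorem theorem1p36:
  fixes M :: "'w measure" and N n :: nat and \<sigma> \<gamma> r :: real
    and s :: "nat \<Rightarrow> complex"
    and noise fi :: "nat \<Rightarrow> 'w \<Rightarrow> nat \<Rightarrow> complex"
    and nbar f :: "'w \<Rightarrow> nat \<Rightarrow> complex"
    and good :: "nat \<Rightarrow> 'w set"
    and C :: "(nat \<Rightarrow> complex) \<Rightarrow> real"
  assumes "prob_space M"
    and "N > 0" and "n > 0" and "\<sigma> > 0" and "0 < \<gamma>" and "\<gamma> < 1"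
    and indep: "prob_space.indep_vars M (\<lambda>_. borel) (\<lambda>(i, x) \<omega>. noise i \<omega> x) ({1..n} \<times> {..<N})"
    and gauss: "\<And>i x. i \<in> {1..n} \<Longrightarrow> x < N \<Longrightarrow> circular_gaussian M (\<sigma>\<^sup>2) (\<lambda>\<omega>. noise i \<omega> x)"
    and fi: "fi = (\<lambda>i \<omega> x. s x + noise i \<omega> x)"
    and f: "f = (\<lambda>\<omega>. sample_mean n (\<lambda>i. fi i \<omega>))"
    and nbar: "nbar = (\<lambda>\<omega>. sample_mean n (\<lambda>i. noise i \<omega>))"
    and r: "r = sqrt (real N) + sqrt (ln (1 / \<gamma>))"
    and good: "good = (\<lambda>i. {\<omega> \<in> space M. lp_norm N 2 (nbar \<omega>) \<le> \<sigma> / sqrt (real n) * r \<and>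
                                            lp_norm N 2 (noise i \<omega>) \<le> \<sigma> * r})"
    and C: "C = (\<lambda>g. 2 * \<sigma> * r / lp_norm N 2 s * (fourier_ratio N g + fourier_ratio N s))"
  shows
    "(\<forall>\<omega> x. f \<omega> x = s x + nbar \<omega> x) \<and>
     (\<forall>i\<in>{1..n}. measure M (good i) \<ge> 1 - \<gamma>) \<and>
     (lp_norm N 2 s \<ge> 2 * \<sigma> * r \<longrightarrow>
       (\<forall>i\<in>{1..n}. measure M {\<omega> \<in> space M.
         \<bar>fourier_ratio N (f \<omega>) - fourier_ratio N s\<bar>
           \<le> 2 * \<sigma> * r / (sqrt (real n) * lp_norm N 2 s)
               * (fourier_ratio N (nbar \<omega>) + fourier_ratio N s) \<and>
         \<bar>fourier_ratio N (fi i \<omega>) - fourier_ratio N s\<bar>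
           \<le> 2 * \<sigma> * r / lp_norm N 2 s
               * (fourier_ratio N (noise i \<omega>) + fourier_ratio N s)} \<ge> 1 - \<gamma>)) \<and>
     (lp_norm N 2 s \<ge> 2 * \<sigma> * r \<longrightarrow>
       (\<forall>i\<in>{1..n}. \<forall>\<omega>\<in>good i.
         \<bar>fourier_ratio N (f \<omega>) - fourier_ratio N s\<bar> \<le> 1 / sqrt (real n) * C (nbar \<omega>) \<and>
         \<bar>fourier_ratio N (fi i \<omega>) - fourier_ratio N s\<bar> \<le> C (noise i \<omega>))) \<and>
     (\<forall>i\<in>{1..n}. distr M borel (\<lambda>\<omega>. fourier_ratio N (nbar \<omega>))
                 = distr M borel (\<lambda>\<omega>. fourier_ratio N (noise i \<omega>)))"
proof -
  interpret prob_space M by fact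
  \<comment> \<open>This \<open>a\<close> makes the tail factor exp (- a^2) equal to
    \<open>\<gamma>\<close>, and it is nonnegative because \<open>\<gamma>\<close> is below
    1.\<close>
  define a where "a = sqrt (ln (1 / \<gamma>))"
  have a: "0 \<le> a" "exp (- a\<^sup>2) = \<gamma>"
    using assms(5,6) by (simp_all add: a_def ln_div)
  have r': "r = sqrt (real N) + a" by (simp add: r a_def)
  have r_pos: "0 < r" using assms(2) a by (simp add: r' add_pos_nonneg)
  have v: "0 < \<sigma>\<^sup>2" using assms(4) by simp

  have full: "indep_vars (\<lambda>_. borel) (\<lambda>((i, x), b) \<omega>. part b (noise i \<omega> x)) (({1..n} \<times> {..<N}) \<times> UNIV)"
  proof -
    have "indep_vars (\<lambda>(j, k). borel) (\<lambda>(j, b) \<omega>. part b ((case j of (i, x) \<Rightarrow> \<lambda>\<omega>. noise i \<omega> x) \<omega>))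
        (Sigma ({1..n} \<times> {..<N}) (\<lambda>_. UNIV))"
    proof (rule indep_vars_Sigma[OF indep])
      fix j assume "j \<in> {1..n} \<times> {..<N}"
      then obtain i x where "j = (i, x)" "i \<in> {1..n}" "x < N" by auto
      then show "indep_vars (\<lambda>_. borel) (\<lambda>b \<omega>. part b ((case j of (i, x) \<Rightarrow> \<lambda>\<omega>. noise i \<omega> x) \<omega>)) UNIV"
        using circular_gaussian_part(2)[OF gauss] by simp
    qed (use assms(2,3) in auto)
    also have "?this \<longleftrightarrow> ?thesis"
      by (intro indep_vars_cong) auto
    finally show ?thesis .
  qed
  have dist: "distributed M lborel (\<lambda>\<omega>. part b (noise i \<omega> x)) (normal_density 0 (sqrt (\<sigma>\<^sup>2 / 2)))"
    if "i \<in> {1..n}" "x < N" for i x b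
    using circular_gaussian_part(1)[OF gauss[OF that]] .

  have noise: "gaussian_noise N (\<sigma>\<^sup>2) (noise i)" if "i \<in> {1..n}" for i
  proof -
    have "indep_vars (\<lambda>_. borel) (\<lambda>((i, x), b) \<omega>. part b (noise i \<omega> x)) (({i} \<times> {..<N}) \<times> UNIV)"
      using that by (intro indep_vars_subset[OF full]) auto
    then have "gaussian_noise N (real (card {i}) * \<sigma>\<^sup>2) (\<lambda>\<omega> x. \<Sum>i\<in>{i}. noise i \<omega> x)"
      using that v by (intro gaussian_noise_sum) (auto intro: dist)
    then show ?thesis by simp
  qed
  \<comment> \<open>The sum of the \<open>n\<close> noises has variance n \<sigma>^2 per entry, and
    scaling by 1 / n divides this by n^2.\<close>
  have nbar_noise: "gaussian_noise N (\<sigma>\<^sup>2 / real n) nbar"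
  proof -
    have "gaussian_noise N (real (card {1..n}) * \<sigma>\<^sup>2) (\<lambda>\<omega> x. \<Sum>i\<in>{1..n}. noise i \<omega> x)"
      using assms(3) v by (intro gaussian_noise_sum full dist) auto
    then have "gaussian_noise N ((1 / real n)\<^sup>2 * (real (card {1..n}) * \<sigma>\<^sup>2))
        (\<lambda>\<omega> x. of_real (1 / real n) * (\<Sum>i\<in>{1..n}. noise i \<omega> x))"
      using assms(3) v by (intro gaussian_noise_scale) auto
    moreover have "(1 / real n)\<^sup>2 * (real (card {1..n}) * \<sigma>\<^sup>2) = \<sigma>\<^sup>2 / real n"
      using assms(3) by (simp add: power2_eq_square)
    moreover have "(\<lambda>\<omega> x. of_real (1 / real n) * (\<Sum>i\<in>{1..n}. noise i \<omega> x)) = nbar"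
      by (simp add: nbar sample_mean_def fun_eq_iff)
    ultimately show ?thesis by (simp only:)
  qed
  note noise_meas = gaussian_noise_measurable[OF noise] and nbar_meas = gaussian_noise_measurable[OF nbar_noise]

  have f_eq: "f \<omega> = (\<lambda>x. s x + nbar \<omega> x)" for \<omega>
    using assms(3) by (simp add: f fi nbar sample_mean_add fun_eq_iff)
  have fi_eq: "fi i \<omega> = (\<lambda>x. s x + noise i \<omega> x)" for i \<omega>
    by (simp add: fi)

  \<comment> \<open>Each of the two norm bounds fails with probability at most \<gamma> / 2. A union
    bound is used, since the average involves noise \<open>i\<close> itself.\<close>
  have good_event: "good i \<in> events" and good_prob: "1 - \<gamma> \<le> prob (good i)" if i: "i \<in> {1..n}" for i
  proof -
    let ?B = "\<lambda>Z c. {\<omega> \<in> space M. \<not> lp_norm N 2 (Z \<omega>) \<le> c}"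
    have [measurable]: "(\<lambda>\<omega>. lp_norm N 2 (nbar \<omega>)) \<in> borel_measurable M"
        "(\<lambda>\<omega>. lp_norm N 2 (noise i \<omega>)) \<in> borel_measurable M"
      using noise_meas[OF i] nbar_meas by (auto intro: lp_norm_2_measurable)
    show ev: "good i \<in> events" unfolding good by measurable
    have "prob (?B nbar (sqrt (\<sigma>\<^sup>2 / real n) * (sqrt (real N) + a))) \<le> exp (- a\<^sup>2) / 2"
      using v assms(2,3) a by (intro gaussian_noise_tail[OF nbar_noise]) auto
    moreover have "prob (?B (noise i) (sqrt (\<sigma>\<^sup>2) * (sqrt (real N) + a))) \<le> exp (- a\<^sup>2) / 2"
      using v assms(2) a by (intro gaussian_noise_tail[OF noise[OF i]]) auto
    moreover have "sqrt (\<sigma>\<^sup>2) = \<sigma>" "sqrt (\<sigma>\<^sup>2 / real n) = \<sigma> / sqrt (real n)"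
      using assms(4) by (simp_all add: real_sqrt_divide)
    ultimately have "prob (?B nbar (\<sigma> / sqrt (real n) * r)) + prob (?B (noise i) (\<sigma> * r)) \<le> \<gamma>"
      using a(2) by (simp add: r')
    moreover have "prob (?B nbar (\<sigma> / sqrt (real n) * r) \<union> ?B (noise i) (\<sigma> * r))
        \<le> prob (?B nbar (\<sigma> / sqrt (real n) * r)) + prob (?B (noise i) (\<sigma> * r))"
      by (rule measure_Un_le) measurable
    moreover have "?B nbar (\<sigma> / sqrt (real n) * r) \<union> ?B (noise i) (\<sigma> * r) = space M - good i"
      unfolding good by blast
    ultimately have "prob (space M - good i) \<le> \<gamma>" by simp
    then show "1 - \<gamma> \<le> prob (good i)" using prob_compl[OF ev] by simp
  qed

  have bounds: "\<bar>fourier_ratio N (f \<omega>) - fourier_ratio N s\<bar>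
           \<le> 2 * \<sigma> * r / (sqrt (real n) * lp_norm N 2 s)
               * (fourier_ratio N (nbar \<omega>) + fourier_ratio N s) \<and>
         \<bar>fourier_ratio N (fi i \<omega>) - fourier_ratio N s\<bar>
           \<le> 2 * \<sigma> * r / lp_norm N 2 s
               * (fourier_ratio N (noise i \<omega>) + fourier_ratio N s)"
    if s: "2 * \<sigma> * r \<le> lp_norm N 2 s" and \<omega>: "\<omega> \<in> good i" for i \<omega>
  proof
    \<comment> \<open>The lower bound on the norm of \<open>s\<close> forces \<open>s\<close> to be
      nonzero, so its Fourier ratio is a genuine one.\<close>
    have s_pos: "0 < lp_norm N 2 s"
      using s assms(4) r_pos by (intro less_le_trans[OF _ s]) simp
    \<comment> \<open>Averaging only lowers the noise threshold, so the same condition on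
      \<open>s\<close> covers the averaged noise.\<close>
    have "1 \<le> sqrt (real n)" using assms(3) by simp
    then have "\<sigma> * r / sqrt (real n) \<le> \<sigma> * r / 1"
      using assms(4) r_pos by (intro divide_left_mono) auto
    then have d: "2 * (\<sigma> / sqrt (real n) * r) \<le> lp_norm N 2 s" using s by simp
    have "\<bar>fourier_ratio N (f \<omega>) - fourier_ratio N s\<bar>
        \<le> 2 * (\<sigma> / sqrt (real n) * r) / lp_norm N 2 s * (fourier_ratio N (nbar \<omega>) + fourier_ratio N s)"
      unfolding f_eq using \<omega> by (intro fourier_ratio_perturb_le assms(2) s_pos d) (simp add: good)
    also have "2 * (\<sigma> / sqrt (real n) * r) / lp_norm N 2 s = 2 * \<sigma> * r / (sqrt (real n) * lp_norm N 2 s)"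
      by simp
    finally show "\<bar>fourier_ratio N (f \<omega>) - fourier_ratio N s\<bar>
           \<le> 2 * \<sigma> * r / (sqrt (real n) * lp_norm N 2 s) * (fourier_ratio N (nbar \<omega>) + fourier_ratio N s)" .
    have "\<bar>fourier_ratio N (fi i \<omega>) - fourier_ratio N s\<bar>
        \<le> 2 * (\<sigma> * r) / lp_norm N 2 s * (fourier_ratio N (noise i \<omega>) + fourier_ratio N s)"
      unfolding fi_eq using \<omega> s by (intro fourier_ratio_perturb_le assms(2) s_pos) (simp_all add: good)
    then show "\<bar>fourier_ratio N (fi i \<omega>) - fourier_ratio N s\<bar>
           \<le> 2 * \<sigma> * r / lp_norm N 2 s * (fourier_ratio N (noise i \<omega>) + fourier_ratio N s)"
      by (simp only: mult.assoc)
  qed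

  have bound_prob: "1 - \<gamma> \<le> prob {\<omega> \<in> space M.
         \<bar>fourier_ratio N (f \<omega>) - fourier_ratio N s\<bar>
           \<le> 2 * \<sigma> * r / (sqrt (real n) * lp_norm N 2 s)
               * (fourier_ratio N (nbar \<omega>) + fourier_ratio N s) \<and>
         \<bar>fourier_ratio N (fi i \<omega>) - fourier_ratio N s\<bar>
           \<le> 2 * \<sigma> * r / lp_norm N 2 s
               * (fourier_ratio N (noise i \<omega>) + fourier_ratio N s)}" (is "_ \<le> prob ?E")
    if s: "2 * \<sigma> * r \<le> lp_norm N 2 s" and i: "i \<in> {1..n}" for i
  proof -
    have [measurable]: "(\<lambda>\<omega>. fourier_ratio N (nbar \<omega>)) \<in> borel_measurable M"
        "(\<lambda>\<omega>. fourier_ratio N (noise i \<omega>)) \<in> borel_measurable M"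
        "(\<lambda>\<omega>. fourier_ratio N (f \<omega>)) \<in> borel_measurable M"
        "(\<lambda>\<omega>. fourier_ratio N (fi i \<omega>)) \<in> borel_measurable M"
      unfolding f_eq fi_eq using noise_meas[OF i] nbar_meas
      by (auto intro!: fourier_ratio_measurable)
    have "?E \<in> events" by measurable
    moreover have "good i \<subseteq> ?E"
      using bounds[OF s] by (auto simp: good)
    ultimately have "prob (good i) \<le> prob ?E" by (intro finite_measure_mono)
    with good_prob[OF i] show ?thesis by linarith
  qed

  \<comment> \<open>Noise \<open>i\<close> divided by sqrt n has the variance of the averaged noise,
    hence the same law of the ratio; the scaling then drops out of the ratio.\<close>
  have law: "distr M borel (\<lambda>\<omega>. fourier_ratio N (nbar \<omega>)) = distr M borel (\<lambda>\<omega>. fourier_ratio N (noise i \<omega>))"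
    if i: "i \<in> {1..n}" for i
  proof -
    have "gaussian_noise N ((1 / sqrt (real n))\<^sup>2 * \<sigma>\<^sup>2) (\<lambda>\<omega> x. of_real (1 / sqrt (real n)) * noise i \<omega> x)"
      using assms(3) v by (intro gaussian_noise_scale noise[OF i]) auto
    also have "(1 / sqrt (real n))\<^sup>2 * \<sigma>\<^sup>2 = \<sigma>\<^sup>2 / real n"
      by (simp add: power_divide)
    finally have "distr M borel (\<lambda>\<omega>. fourier_ratio N (nbar \<omega>)) =
        distr M borel (\<lambda>\<omega>. fourier_ratio N (\<lambda>x. of_real (1 / sqrt (real n)) * noise i \<omega> x))"
      by (intro gaussian_noise_law[OF nbar_noise] assms(2))
    then show ?thesis using assms(3) by (subst (asm) fourier_ratio_cmult) auto
  qed

  have C_eq: "1 / sqrt (real n) * C g = 2 * \<sigma> * r / (sqrt (real n) * lp_norm N 2 s)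
      * (fourier_ratio N g + fourier_ratio N s)" for g
    by (simp add: C)
  show ?thesis
    unfolding C_eq using good_prob bounds bound_prob law by (auto simp: f_eq C)
qed

end
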